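(* Let $X$ be a completely regular Hausdorff space. The zero-set intersection graph $\Gamma(C(X))$ is chordal if and only if $|X|\le 3$.
   Context: $C(X)$ is the ring of all continuous functions $X\to\mathbb{R}$ with pointwise operations. For $f\in C(X)$, $Z(f)=\{x\in X: f(x)=0\}$. $\Gamma(C(X))$ is the simple graph whose vertex set is the set of non-units of $C(X)$ (equivalently, the $f$ with $Z(f)\neq\emptyset$), two distinct vertices $f,g$ being adjacent iff $Z(f)\cap Z(g)\neq\emptyset$. A graph is chordal if every cycle of length greater than three has a chord, i.e. an edge joining two vertices of the cycle that is not itself an edge of the cycle. *)

theory Defs
  imports "HOL-Analysis.Analysis" "HOL-Algebra.Ring"
begin

(* HOL functions are total, so a real function on X is represented by the unique
   HOL function that agrees with it on the space and is undefined elsewhere;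
   equality in the carrier is therefore equality of functions on X. *)

definition cont_ring :: "'a topology \<Rightarrow> ('a \<Rightarrow> real) ring" where
  "cont_ring X =
    \<lparr> carrier = {f. continuous_map X euclideanreal f \<and> f \<in> extensional (topspace X)},
      mult = (\<lambda>f g. \<lambda>x\<in>topspace X. f x * g x),
      one = (\<lambda>x\<in>topspace X. 1),
      zero = (\<lambda>x\<in>topspace X. 0),
      add = (\<lambda>f g. \<lambda>x\<in>topspace X. f x + g x) \<rparr>"

lemma continuous_map_restrict_topspace: "continuous_map X euclideanreal g \<Longrightarrow> continuous_map X euclideanreal (\<lambda>x\<in>topspace X. g x)"
  by (rule continuous_map_eq) auto

lemma cring_cont_ring: "cring (cont_ring X)"
proof (rule cringI)
  show "abelian_group (cont_ring X)"
  proof (rule abelian_groupI)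
    fix f assume f: "f \<in> carrier (cont_ring X)"
    show "\<exists>g\<in>carrier (cont_ring X). g \<oplus>\<^bsub>cont_ring X\<^esub> f = \<zero>\<^bsub>cont_ring X\<^esub>"
      by (rule bexI[of _ "\<lambda>x\<in>topspace X. - f x"])
        (use f in \<open>auto simp: cont_ring_def fun_eq_iff intro!: continuous_map_restrict_topspace continuous_map_minus\<close>)
  qed (auto simp: cont_ring_def fun_eq_iff algebra_simps extensional_def intro!: continuous_map_restrict_topspace continuous_map_add)
  show "comm_monoid (cont_ring X)"
    by (rule comm_monoidI) (auto simp: cont_ring_def fun_eq_iff algebra_simps extensional_def 
      intro!: continuous_map_restrict_topspace continuous_map_real_mult)
qed (auto simp: cont_ring_def fun_eq_iff algebra_simps extensional_def)

definition zero_set :: "'a topology \<Rightarrow> ('a \<Rightarrow> real) \<Rightarrow> 'a set" where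
  "zero_set X f = {x \<in> topspace X. f x = 0}"

(* A simple graph is a pair of its vertex set and its set of edges, an edge being the
   two-element set of its endpoints. No finiteness is assumed. *)

type_synonym 'v sgraph = "'v set \<times> 'v set set"

(* A cycle is given by the list of its distinct vertices in cyclic order; the last vertex
   is joined to the first. Its length, the number of its edges, is the length of the list. *)

definition cycle_edges :: "'v list \<Rightarrow> 'v set set" where
  "cycle_edges vs = {{vs ! i, vs ! (Suc i mod length vs)} | i. i < length vs}"

definition graph_cycle :: "'v sgraph \<Rightarrow> 'v list \<Rightarrow> bool" where
  "graph_cycle G vs \<longleftrightarrow>
     3 \<le> length vs \<and> distinct vs \<and> set vs \<subseteq> fst G \<and> cycle_edges vs \<subseteq> snd G"

definition chord :: "'v sgraph \<Rightarrow> 'v list \<Rightarrow> 'v set \<Rightarrow> bool" where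
  "chord G vs e \<longleftrightarrow> e \<in> snd G \<and> e \<subseteq> set vs \<and> e \<notin> cycle_edges vs"

definition chordal :: "'v sgraph \<Rightarrow> bool" where
  "chordal G \<longleftrightarrow> (\<forall>vs. graph_cycle G vs \<and> length vs > 3 \<longrightarrow> (\<exists>e. chord G vs e))"

definition zero_set_graph :: "'a topology \<Rightarrow> ('a \<Rightarrow> real) sgraph" where
  "zero_set_graph X =
    (let V = carrier (cont_ring X) - Units (cont_ring X)
     in (V, {{f, g} | f g. f \<in> V \<and> g \<in> V \<and> f \<noteq> g \<and> zero_set X f \<inter> zero_set X g \<noteq> {}}))"

end

theory Submission
  imports Defs
begin

text \<open>In a cycle of length at least four without chords, vertices two steps apart have disjoint
  zero sets. Hence the points witnessing four consecutive edges are distinct, and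
  X has at least four points. Conversely, if \<open>a, b, c, d\<close> are distinct points, choose
  \<open>f\<close> vanishing at \<open>a, b\<close> and equal to 1 at \<open>c, d\<close>, and \<open>g\<close> vanishing at \<open>b, c\<close> and equal to 1
  at \<open>d, a\<close>; then \<open>f, g, 1 - f, 1 - g\<close> is a chordless 4-cycle.\<close>

text \<open>Evaluation at the common point \<open>x\<close> sends every multiple of \<open>f\<close>
  to 0 but the identity of the ring to 1, so \<open>f\<close> has no inverse.\<close>

lemma vertex_zero_set_graphI:
  assumes "f \<in> carrier (cont_ring X)" and "x \<in> zero_set X f"
  shows "f \<in> fst (zero_set_graph X)"
proof -
  have x: "x \<in> topspace X" "f x = 0"
    using assms(2) by (auto simp: zero_set_def)
  have "g \<otimes>\<^bsub>cont_ring X\<^esub> f \<noteq> \<one>\<^bsub>cont_ring X\<^esub>" for g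
  proof
    assume "g \<otimes>\<^bsub>cont_ring X\<^esub> f = \<one>\<^bsub>cont_ring X\<^esub>"
    from fun_cong[OF this, of x] x show False
      by (simp add: cont_ring_def)
  qed
  then show ?thesis
    using assms(1) by (auto simp: zero_set_graph_def Let_def Units_def)
qed

lemma edge_zero_set_graph_iff:
  "{f, g} \<in> snd (zero_set_graph X) \<longleftrightarrow>
     f \<in> fst (zero_set_graph X) \<and> g \<in> fst (zero_set_graph X) \<and> f \<noteq> g \<and>
     zero_set X f \<inter> zero_set X g \<noteq> {}"
  unfolding zero_set_graph_def Let_def by (auto simp: doubleton_eq_iff)

text \<open>The bound on the length is what makes this work: in a triangle, going two steps forward
  is the same as going one step back.\<close>

lemma two_steps_not_cycle_edge:
  assumes "distinct vs" "3 < length vs" "i < length vs"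
  shows "vs ! i \<noteq> vs ! ((i + 2) mod length vs)"
    and "{vs ! i, vs ! ((i + 2) mod length vs)} \<notin> cycle_edges vs"
proof -
  let ?n = "length vs"
  define k where "k = (i + 2) mod ?n"
  \<comment> \<open>Since \<open>i + 2\<close> is below twice the length, it wraps around at most
    once; the case distinction replaces the modulus by linear arithmetic.\<close>
  have k: "k = (if i + 2 < ?n then i + 2 else i + 2 - ?n)"
    using assms by (auto simp: k_def mod_if)
  have kn: "k < ?n" and ik: "i \<noteq> k"
    using k assms by (auto split: if_splits)
  then show "vs ! i \<noteq> vs ! ((i + 2) mod length vs)"
    unfolding k_def[symmetric] using assms by (simp add: nth_eq_iff_index_eq)
  have "{vs ! i, vs ! k} \<noteq> {vs ! j, vs ! (Suc j mod ?n)}" if "j < ?n" for j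
  proof -
    define l where "l = Suc j mod ?n"
    have l: "l = (if Suc j = ?n then 0 else Suc j)" "l < ?n"
      using that by (auto simp: l_def mod_Suc)
    \<comment> \<open>As the vertices are distinct, these are the only two ways in which the
      doubletons could coincide.\<close>
    have "\<not> (i = j \<and> k = l)" "\<not> (i = l \<and> k = j)"
      using k l assms by (auto split: if_splits)
    then show ?thesis
      unfolding l_def[symmetric] using assms kn l(2) that
      by (simp add: doubleton_eq_iff nth_eq_iff_index_eq)
  qed
  then show "{vs ! i, vs ! ((i + 2) mod length vs)} \<notin> cycle_edges vs"
    unfolding k_def[symmetric] by (auto simp: cycle_edges_def)
qed

lemma four_points_if_chordless:
  assumes cyc: "graph_cycle (zero_set_graph X) vs" and len: "3 < length vs"
    and chordless: "\<nexists>e. chord (zero_set_graph X) vs e"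
  obtains P where "P \<subseteq> topspace X" "card P = 4"
proof -
  let ?n = "length vs"
  \<comment> \<open>Indices wrap around so that \<open>Z 4\<close> makes sense for every cycle
    considered; in a 4-cycle it is \<open>Z 0\<close>.\<close>
  define Z where "Z i = zero_set X (vs ! (i mod ?n))" for i
  have vs: "distinct vs" "set vs \<subseteq> fst (zero_set_graph X)"
    "cycle_edges vs \<subseteq> snd (zero_set_graph X)"
    using cyc by (auto simp: graph_cycle_def)
  have meet: "\<exists>x. x \<in> Z i \<and> x \<in> Z (Suc i)" if "i < ?n" for i
  proof -
    have "{vs ! i, vs ! (Suc i mod ?n)} \<in> snd (zero_set_graph X)"
      using that vs(3) by (auto simp: cycle_edges_def)
    then show ?thesis
      using that by (auto simp: edge_zero_set_graph_iff Z_def)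
  qed
  have disj: "Z i \<inter> Z (i + 2) = {}" if "i < ?n" for i
  proof (rule ccontr)
    assume meets: "Z i \<inter> Z (i + 2) \<noteq> {}"
    let ?e = "{vs ! i, vs ! ((i + 2) mod ?n)}"
    have "(i + 2) mod ?n < ?n"
      using len by (intro mod_less_divisor) auto
    then have e: "?e \<subseteq> set vs"
      using that by simp
    moreover have "?e \<in> snd (zero_set_graph X)"
      using e vs(2) meets that two_steps_not_cycle_edge(1)[OF vs(1) len that]
      by (auto simp: edge_zero_set_graph_iff Z_def)
    ultimately have "chord (zero_set_graph X) vs ?e"
      using two_steps_not_cycle_edge(2)[OF vs(1) len that] by (simp add: chord_def)
    then show False
      using chordless by blast
  qed
  have "0 < ?n" "1 < ?n" "2 < ?n"
    using len by linarith+
  obtain p q r s where pts: "p \<in> Z 0" "p \<in> Z 1" "q \<in> Z 1" "q \<in> Z 2"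
      "r \<in> Z 2" "r \<in> Z 3" "s \<in> Z 3" "s \<in> Z 4"
    using meet[OF \<open>0 < ?n\<close>] meet[OF \<open>1 < ?n\<close>] meet[OF \<open>2 < ?n\<close>] meet[OF len]
    by (auto simp: numeral_eq_Suc)
  \<comment> \<open>The first equation separates \<open>p\<close> from \<open>q\<close>, the second
    separates both of them from \<open>r\<close> and \<open>s\<close>, and the third separates
    \<open>r\<close> from \<open>s\<close>.\<close>
  have "Z 0 \<inter> Z 2 = {}" "Z 1 \<inter> Z 3 = {}" "Z 2 \<inter> Z 4 = {}"
    using disj[OF \<open>0 < ?n\<close>] disj[OF \<open>1 < ?n\<close>] disj[OF \<open>2 < ?n\<close>]
    by (simp_all add: numeral_eq_Suc)
  with pts have "p \<noteq> q" "p \<noteq> r" "p \<noteq> s" "q \<noteq> r" "q \<noteq> s" "r \<noteq> s"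
    by blast+
  then have "card {p, q, r, s} = 4"
    by simp
  moreover have "{p, q, r, s} \<subseteq> topspace X"
    using pts by (auto simp: Z_def zero_set_def)
  ultimately show thesis
    using that by blast
qed

text \<open>Finite sets are compact, hence closed in a Hausdorff space, and complete regularity
  separates a compact set from a disjoint closed one by a continuous function.\<close>

lemma cont_ring_separates_pairs:
  assumes "completely_regular_space X" "Hausdorff_space X"
    and "{a, b, c, d} \<subseteq> topspace X" "{a, b} \<inter> {c, d} = {}"
  obtains f where "f \<in> carrier (cont_ring X)" "f a = 0" "f b = 0" "f c = 1" "f d = 1"
proof -
  have "compactin X {a, b}" "compactin X {c, d}"
    using assms(3) by (auto intro!: finite_imp_compactin)
  then have "compactin X {a, b}" "closedin X {c, d}"
    using assms(2) compactin_imp_closedin by blast+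
  moreover have "disjnt {a, b} {c, d}"
    using assms(4) by (simp add: disjnt_def)
  ultimately obtain f where "continuous_map X euclideanreal f"
      "f ` {c, d} \<subseteq> {1}" "f ` {a, b} \<subseteq> {0}"
    using Urysohn_completely_regular_compact_closed_alt[OF assms(1)] by blast
  \<comment> \<open>Restriction makes the function extensional, as membership in the carrier
    demands.\<close>
  then show thesis
    using assms(3) by (intro that[of "restrict f (topspace X)"])
      (auto simp: cont_ring_def intro: continuous_map_restrict_topspace)
qed

text \<open>Once the four sides of a square are excluded, only its diagonals and the degenerate
  pairs are left.\<close>

lemma non_edge_of_square:
  assumes "u \<in> {p, q, r, s}" "v \<in> {p, q, r, s}" "{u, v} \<notin> {{p, q}, {q, r}, {r, s}, {s, p}}"
  shows "{u, v} = {p, r} \<or> {u, v} = {q, s} \<or> u = v"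
  using assms by (elim insertE emptyE) (simp_all add: insert_commute)

lemma not_chordal_if_four_points:
  assumes X: "completely_regular_space X" "Hausdorff_space X"
    and P: "{a, b, c, d} \<subseteq> topspace X" "distinct [a, b, c, d]"
  shows "\<not> chordal (zero_set_graph X)"
proof
  assume chordal: "chordal (zero_set_graph X)"
  have "{a, b, c, d} \<subseteq> topspace X" "{a, b} \<inter> {c, d} = {}"
    using P by auto
  then obtain f where f: "f \<in> carrier (cont_ring X)" "f a = 0" "f b = 0" "f c = 1" "f d = 1"
    by (rule cont_ring_separates_pairs[OF X])
  have "{b, c, d, a} \<subseteq> topspace X" "{b, c} \<inter> {d, a} = {}"
    using P by auto
  then obtain g where g: "g \<in> carrier (cont_ring X)" "g b = 0" "g c = 0" "g d = 1" "g a = 1"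
    by (rule cont_ring_separates_pairs[OF X])
  define compl where "compl h = (\<lambda>x\<in>topspace X. 1 - h x)" for h :: "'a \<Rightarrow> real"
  have compl_carrier: "compl h \<in> carrier (cont_ring X)" if "h \<in> carrier (cont_ring X)" for h
    using that by (auto simp: cont_ring_def compl_def
        intro!: continuous_map_restrict_topspace continuous_map_diff)
  \<comment> \<open>This is what keeps the two diagonals of the 4-cycle from being edges.\<close>
  have compl_disjoint: "zero_set X h \<inter> zero_set X (compl h) = {}" for h
    by (auto simp: zero_set_def compl_def)
  \<comment> \<open>Going around the cycle \<open>f\<close>, \<open>g\<close>,
    \<open>compl f\<close>, \<open>compl g\<close>, consecutive vertices share the zeros
    \<open>b\<close>, \<open>c\<close>, \<open>d\<close>, \<open>a\<close> in turn.\<close>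
  have Z: "a \<in> zero_set X f" "b \<in> zero_set X f" "b \<in> zero_set X g" "c \<in> zero_set X g"
    "c \<in> zero_set X (compl f)" "d \<in> zero_set X (compl f)"
    "d \<in> zero_set X (compl g)" "a \<in> zero_set X (compl g)"
    using f g P(1) by (auto simp: zero_set_def compl_def)
  let ?vs = "[f, g, compl f, compl g]"
  have dist: "distinct ?vs"
  proof -
    \<comment> \<open>Each of the six pairs of vertices is told apart at one of the points
      \<open>a\<close>, \<open>b\<close>, \<open>c\<close>, where one function is 0 and the other is
      1.\<close>
    have neq: "h \<noteq> k" if "h x = 0" "k x = 1" for h k :: "'a \<Rightarrow> real" and x
      using that by auto
    have "compl f c = 0" "compl f a = 1" "compl f b = 1" "compl g a = 0" "compl g b = 1"
      using f g P(1) by (auto simp: compl_def)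
    then have "g \<noteq> f" "compl f \<noteq> f" "f \<noteq> compl g" "g \<noteq> compl f" "g \<noteq> compl g" "compl g \<noteq> compl f"
      using f g neq[of f a g] neq[of "compl f" c f] neq[of f b "compl g"]
        neq[of g b "compl f"] neq[of g b "compl g"] neq[of "compl g" a "compl f"] by simp_all
    then show ?thesis
      by auto
  qed
  have V: "set ?vs \<subseteq> fst (zero_set_graph X)"
    using Z f(1) g(1) compl_carrier by (auto intro: vertex_zero_set_graphI)
  have ce: "cycle_edges ?vs =
      {{f, g}, {g, compl f}, {compl f, compl g}, {compl g, f}}"
  proof -
    have "cycle_edges ?vs = (\<lambda>i. {?vs ! i, ?vs ! (Suc i mod length ?vs)}) ` {..<length ?vs}"
      unfolding cycle_edges_def by blast
    also have "{..<length ?vs} = {0, 1, 2, 3}"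
      by auto
    finally show ?thesis
      by simp
  qed
  have "cycle_edges ?vs \<subseteq> snd (zero_set_graph X)"
    unfolding ce using V dist Z by (auto simp: edge_zero_set_graph_iff)
  then have "graph_cycle (zero_set_graph X) ?vs"
    using V dist by (simp add: graph_cycle_def)
  then obtain e where e: "chord (zero_set_graph X) ?vs e"
    using chordal by (force simp: chordal_def)
  then have "e \<in> snd (zero_set_graph X)"
    by (simp add: chord_def)
  then obtain u v where "e = {u, v}" and uv: "{u, v} \<in> snd (zero_set_graph X)"
    unfolding zero_set_graph_def Let_def snd_conv by blast
  with e have "u \<in> set ?vs" "v \<in> set ?vs" "{u, v} \<notin> cycle_edges ?vs"
    by (auto simp: chord_def)
  \<comment> \<open>A chord would have to be a diagonal, whose endpoints have no common
    zero.\<close>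
  then have "{u, v} = {f, compl f} \<or> {u, v} = {g, compl g} \<or> u = v"
    unfolding ce list.set by (rule non_edge_of_square)
  moreover have "u \<noteq> v" "zero_set X u \<inter> zero_set X v \<noteq> {}"
    using uv by (auto simp: edge_zero_set_graph_iff)
  ultimately show False
    using compl_disjoint[of f] compl_disjoint[of g]
    by (auto simp: doubleton_eq_iff)
qed

theorem theorem3p4:
  fixes X :: "'a topology"
  assumes "completely_regular_space X" and "Hausdorff_space X"
  shows "chordal (zero_set_graph X) \<longleftrightarrow> finite (topspace X) \<and> card (topspace X) \<le> 3"
proof
  assume chordal: "chordal (zero_set_graph X)"
  show "finite (topspace X) \<and> card (topspace X) \<le> 3"
  proof (rule ccontr)
    assume large: "\<not> ?thesis"
    \<comment> \<open>Infinite spaces need their own case because \<open>card\<close> is 0 on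
      infinite sets.\<close>
    obtain P where P: "P \<subseteq> topspace X" "card P = 4"
    proof (cases "finite (topspace X)")
      case True
      with large have "4 \<le> card (topspace X)"
        by simp
      then show thesis
        using that obtain_subset_with_card_n by metis
    qed (use infinite_arbitrarily_large in metis)
    obtain ps where ps: "set ps = P" "distinct ps"
      using P(2) by (metis card.infinite finite_distinct_list zero_neq_numeral)
    then have "length ps = 4"
      using P(2) distinct_card by fastforce
    then obtain a b c d where "ps = [a, b, c, d]"
      by (auto simp: length_Suc_conv numeral_eq_Suc)
    then show False
      using not_chordal_if_four_points[OF assms, of a b c d] ps P(1) chordal by auto
  qed
next
  assume small: "finite (topspace X) \<and> card (topspace X) \<le> 3"
  show "chordal (zero_set_graph X)"
    unfolding chordal_def
  proof (intro allI impI, elim conjE, rule ccontr)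
    fix vs
    assume "graph_cycle (zero_set_graph X) vs" "length vs > 3"
      "\<nexists>e. chord (zero_set_graph X) vs e"
    then obtain P where "P \<subseteq> topspace X" "card P = 4"
      by (rule four_points_if_chordless)
    then show False
      using small card_mono[of "topspace X" P] by auto
  qed
qed

end
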